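(* For a coherent quantale $A$ the following are equivalent: (1) $A$ is a $PF$-quantale; (2) $A$ is a semiprime $mp$-quantale; (3) if $c,d\in K(A)$ then $cd=0$ implies $c^{\perp}\vee d^{\perp}=1$; (4) if $c,d\in K(A)$ then $(cd)^{\perp}=c^{\perp}\vee d^{\perp}$; (5) for each $c\in K(A)$, $c^{\perp}$ is a pure element.
   Context: A quantale here means a complete lattice $A$ with bottom $0$ and top $1$, with an associative commutative multiplication that distributes over arbitrary joins and has $1$ as unit. $K(A)$ is the set of compact elements. $A$ is coherent if every element is a join of compact elements, $1\in K(A)$, and $K(A)$ is closed under multiplication. An element $p<1$ is $m$-prime if for all $a,b\in A$, $ab\leq p$ implies $a\leq p$ or $b\leq p$; $Spec(A)$ is the set of $m$-prime elements and $Min(A)$ is the set of minimal elements of $Spec(A)$. $\rho(a)=\bigwedge\{p\in Spec(A): a\leq p\}$; $A$ is semiprime if $\rho(0)=0$. $A$ is an $mp$-quantale if for any $p\in Spec(A)$ there exists a unique $q\in Min(A)$ with $q\leq p$. $a^{\perp}=\bigvee\{x\in A: ax=0\}$. An element $a\in A$ is pure if for all $c\in K(A)$, $c\leq a$ implies $a\vee c^{\perp}=1$. $A$ is a $PF$-quantale if $c^{\perp}$ is pure for each $c\in K(A)$ (so (5) is the definition of (1)). *)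

theory Defs
  imports Main
begin

text \<open>The least and greatest elements \<open>0\<close> and \<open>1\<close> of a quantale are \<^const>\<open>bot\<close> and
  \<^const>\<open>top\<close>; the one-element quantale (\<open>bot = top\<close>) is not excluded.\<close>

class quantale = complete_lattice + comm_monoid_mult +
  assumes one_eq_top: "1 = top"
    and mult_Sup: "a * Sup B = Sup ((\<lambda>b. a * b) ` B)"

definition compact_elements :: "'a::complete_lattice set" where
  "compact_elements = {c. \<forall>S. c \<le> Sup S \<longrightarrow> (\<exists>T\<subseteq>S. finite T \<and> c \<le> Sup T)}"

text \<open>Properties of a quantale as a whole take the type carrying it as an argument.\<close>

definition coherent_quantale :: "'a::quantale itself \<Rightarrow> bool" where
  "coherent_quantale _ \<longleftrightarrow>
     (\<forall>a::'a. \<exists>S\<subseteq>compact_elements. a = Sup S) \<and>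
     (top::'a) \<in> compact_elements \<and>
     (\<forall>c\<in>compact_elements. \<forall>d\<in>compact_elements. c * d \<in> (compact_elements :: 'a set))"

definition m_prime :: "'a::quantale \<Rightarrow> bool" where
  "m_prime p \<longleftrightarrow> p < top \<and> (\<forall>a b. a * b \<le> p \<longrightarrow> a \<le> p \<or> b \<le> p)"

definition Spec :: "'a::quantale set" where
  "Spec = {p. m_prime p}"

definition Min_Spec :: "'a::quantale set" where
  "Min_Spec = {p \<in> Spec. \<forall>q\<in>Spec. q \<le> p \<longrightarrow> q = p}"

definition radical :: "'a::quantale \<Rightarrow> 'a" where
  "radical a = Inf {p \<in> Spec. a \<le> p}"

definition semiprime_quantale :: "'a::quantale itself \<Rightarrow> bool" where
  "semiprime_quantale _ \<longleftrightarrow> radical (bot::'a) = bot"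

definition mp_quantale :: "'a::quantale itself \<Rightarrow> bool" where
  "mp_quantale _ \<longleftrightarrow> (\<forall>p\<in>(Spec::'a set). \<exists>!q. q \<in> Min_Spec \<and> q \<le> p)"

definition annihilator :: "'a::quantale \<Rightarrow> 'a"  (\<open>_\<^sup>\<perp>\<close> [1000] 999) where
  "a\<^sup>\<perp> = Sup {x. a * x = bot}"

definition pure_element :: "'a::quantale \<Rightarrow> bool" where
  "pure_element a \<longleftrightarrow> (\<forall>c\<in>compact_elements. c \<le> a \<longrightarrow> sup a (c\<^sup>\<perp>) = top)"

definition PF_quantale :: "'a::quantale itself \<Rightarrow> bool" where
  "PF_quantale _ \<longleftrightarrow> (\<forall>c\<in>(compact_elements::'a set). pure_element (c\<^sup>\<perp>))"

end

theory Submission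
  imports Defs
begin

text \<open>The engine is prime separation: in a coherent quantale, an element with no member of a
  multiplicatively closed set \<open>M\<close> of compact elements below it extends to an \<open>m\<close>-prime element
  with the same property.  For \<open>M = {c ^ n}\<close> this makes every compact element below
  \<open>radical bot\<close> nilpotent.  For \<open>M = {s * c ^ n | \<not> s \<le> p}\<close> in a semiprime quantale it shows that
  \<open>c\<^sup>\<perp> \<le> p\<close> forces an \<open>m\<close>-prime \<open>q \<le> p\<close> with \<open>\<not> c \<le> q\<close>; this links annihilators to the
  minimal \<open>m\<close>-primes below \<open>p\<close>.\<close>

section \<open>Multiplication and annihilators\<close>

lemma quantale_mult_sup: "a * sup b c = sup (a * b) (a * c)" for a :: "'a::quantale"
  using mult_Sup[of a "{b, c}"] by simp

lemma quantale_mult_bot: "a * bot = bot" for a :: "'a::quantale"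
  using mult_Sup[of a "{}"] by simp

lemma quantale_mult_right_mono: "b \<le> c \<Longrightarrow> a * b \<le> a * c" for a :: "'a::quantale"
  by (metis le_iff_sup quantale_mult_sup)

lemma quantale_mult_mono: "a \<le> b \<Longrightarrow> c \<le> d \<Longrightarrow> a * c \<le> b * d" for a :: "'a::quantale"
  by (metis mult.commute order_trans quantale_mult_right_mono)

lemma quantale_mult_top: "a * top = a" for a :: "'a::quantale"
  by (metis mult.right_neutral one_eq_top)

lemma quantale_mult_le_left: "a * b \<le> a" for a :: "'a::quantale"
  by (metis quantale_mult_right_mono quantale_mult_top top_greatest)

lemma quantale_mult_le_right: "a * b \<le> b" for a :: "'a::quantale"
  by (metis mult.commute quantale_mult_le_left)

lemma mult_annihilator: "a * a\<^sup>\<perp> = bot"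
  by (auto simp: annihilator_def mult_Sup intro!: Sup_eqI)

text \<open>By distributivity the join defining \<open>a\<^sup>\<perp>\<close> itself annihilates
  \<open>a\<close>, so it is the greatest such element. Bounds by annihilators thereby become
  equations.\<close>

lemma le_annihilator_iff: "x \<le> a\<^sup>\<perp> \<longleftrightarrow> a * x = bot"
proof
  assume "x \<le> a\<^sup>\<perp>"
  then show "a * x = bot"
    by (metis bot_unique mult_annihilator quantale_mult_right_mono)
qed (auto simp: annihilator_def intro: Sup_upper)

lemma annihilator_top: "(top::'a::quantale)\<^sup>\<perp> = bot"
  by (metis mult.commute mult_annihilator quantale_mult_top)

lemma annihilator_eq_top_iff: "a\<^sup>\<perp> = top \<longleftrightarrow> a = bot"
  by (metis le_annihilator_iff quantale_mult_top top_unique)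

text \<open>The half of the product formula for annihilators that holds in every quantale.\<close>

lemma sup_annihilator_le: "sup (a\<^sup>\<perp>) (b\<^sup>\<perp>) \<le> (a * b)\<^sup>\<perp>"
proof (rule sup_least)
  show "a\<^sup>\<perp> \<le> (a * b)\<^sup>\<perp>"
    by (metis le_annihilator_iff mult.commute mult.left_commute mult_annihilator quantale_mult_bot)
  show "b\<^sup>\<perp> \<le> (a * b)\<^sup>\<perp>"
    by (metis le_annihilator_iff mult.assoc mult_annihilator quantale_mult_bot)
qed

section \<open>Prime elements\<close>

lemma SpecD: "p \<in> Spec \<Longrightarrow> a * b \<le> p \<Longrightarrow> a \<le> p \<or> b \<le> p"
  by (simp add: Spec_def m_prime_def)

lemma Spec_not_top: "p \<in> Spec \<Longrightarrow> \<not> top \<le> p"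
  by (auto simp: Spec_def m_prime_def)

lemma Spec_powerD: "p \<in> Spec \<Longrightarrow> a ^ n \<le> p \<Longrightarrow> a \<le> p"
  \<comment> \<open>The case \<open>n = 0\<close> is vacuous: \<open>a ^ 0\<close> is
    \<open>top\<close>, which lies below no m-prime.\<close>
  by (induction n) (auto simp: one_eq_top dest: SpecD Spec_not_top)

lemma Spec_annihilator_le: "p \<in> Spec \<Longrightarrow> \<not> a \<le> p \<Longrightarrow> a\<^sup>\<perp> \<le> p"
  by (metis SpecD bot_least mult_annihilator)

lemma semiprime_eq_botI:
  assumes "semiprime_quantale TYPE('a::quantale)" "\<And>p. p \<in> Spec \<Longrightarrow> (a::'a) \<le> p"
  shows "a = bot"
proof -
  have "a \<le> radical bot"
    using assms(2) by (auto simp: radical_def intro: Inf_greatest)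
  then show ?thesis
    using assms(1) by (simp add: semiprime_quantale_def bot_unique)
qed

section \<open>Prime and minimal prime elements from Zorn's lemma\<close>

lemma Sup_finite_chain_mem:
  fixes T :: "'a::complete_lattice set"
  assumes "finite T" "T \<noteq> {}" "\<And>x y. x \<in> T \<Longrightarrow> y \<in> T \<Longrightarrow> x \<le> y \<or> y \<le> x"
  shows "Sup T \<in> T"
  using assms
proof (induction T rule: finite_ne_induct)
  case (insert x F)
  then have "Sup F \<in> F" "x \<le> Sup F \<or> Sup F \<le> x"
    by auto
  then show ?case
    by (auto simp: sup_absorb1 sup_absorb2)
qed simp

text \<open>Compactness leaves a finite part of the chain, and the join of a nonempty finite chain
  is one of its members. If that part is empty, \<open>m\<close> is \<open>bot\<close> and any
  member of \<open>C\<close> serves.\<close>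

lemma compact_le_Sup_chain:
  assumes "m \<in> compact_elements" "m \<le> Sup C" "C \<noteq> {}"
    and chain: "\<And>x y. x \<in> C \<Longrightarrow> y \<in> C \<Longrightarrow> x \<le> y \<or> y \<le> x"
  shows "\<exists>x\<in>C. m \<le> x"
proof -
  obtain T where T: "T \<subseteq> C" "finite T" "m \<le> Sup T"
    using assms(1,2) by (auto simp: compact_elements_def)
  show ?thesis
  proof (cases "T = {}")
    case True
    then show ?thesis
      using T \<open>C \<noteq> {}\<close> by (auto simp: bot_unique)
  next
    case False
    then have "Sup T \<in> T"
      using T chain by (intro Sup_finite_chain_mem) auto
    then show ?thesis
      using T by blast
  qed
qed

text \<open>Zorn's lemma gives a maximal element of the family in question: compactness keeps joins
  of chains inside it. Maximality and closure of \<open>M\<close> under products then force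
  primeness.\<close>

lemma prime_separation:
  fixes a :: "'a::quantale"
  assumes M: "M \<subseteq> compact_elements" "M \<noteq> {}"
    and M_mult: "\<And>m n. m \<in> M \<Longrightarrow> n \<in> M \<Longrightarrow> m * n \<in> M"
    and a: "\<And>m. m \<in> M \<Longrightarrow> \<not> m \<le> a"
  obtains p where "p \<in> Spec" "a \<le> p" "\<And>m. m \<in> M \<Longrightarrow> \<not> m \<le> p"
proof -
  define X where "X = {b. a \<le> b \<and> (\<forall>m\<in>M. \<not> m \<le> b)}"
  have "\<exists>p\<in>X. \<forall>b\<in>X. p \<le> b \<longrightarrow> b = p"
  proof (rule predicate_Zorn)
    show "partial_order_on X (relation_of (\<le>) X)"
      by (rule partial_order_on_relation_ofI) auto
  next
    fix C assume C: "C \<in> Chains (relation_of (\<le>) X)"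
    have CX: "C \<subseteq> X" and chain: "x \<le> y \<or> y \<le> x" if "x \<in> C" "y \<in> C" for x y
      using C that by (auto simp: Chains_def relation_of_def)
    show "\<exists>u\<in>X. \<forall>x\<in>C. x \<le> u"
    proof (cases "C = {}")
      case True
      then show ?thesis using a by (auto simp: X_def)
    next
      case False
      then obtain x where "x \<in> C" by blast
      then have "x \<in> X" "x \<le> Sup C"
        using CX by (auto intro: Sup_upper)
      then have "a \<le> Sup C"
        by (auto simp: X_def)
      moreover have "\<not> m \<le> Sup C" if "m \<in> M" for m
        using compact_le_Sup_chain[of m C] chain CX False M that
        by (fastforce simp: X_def)
      ultimately have "Sup C \<in> X"
        by (simp add: X_def)
      then show ?thesis
        by (auto intro: Sup_upper)
    qed
  qed
  then obtain p where p: "p \<in> X" and max: "\<And>b. b \<in> X \<Longrightarrow> p \<le> b \<Longrightarrow> b = p"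
    by blast
  \<comment> \<open>By maximality, joining \<open>p\<close> with anything not below it captures a
    member of \<open>M\<close>.\<close>
  have ex: "\<exists>m\<in>M. m \<le> sup p x" if "\<not> x \<le> p" for x
  proof (rule ccontr)
    assume "\<not> ?thesis"
    with p have "sup p x \<in> X"
      by (auto simp: X_def intro: le_supI1)
    from max[OF this] that show False
      by (metis sup_ge1 sup_ge2)
  qed
  have "x \<le> p \<or> y \<le> p" if "x * y \<le> p" for x y
  proof (rule ccontr)
    assume "\<not> ?thesis"
    with ex obtain m n where mn: "m \<in> M" "n \<in> M" "m \<le> sup p x" "n \<le> sup p y"
      by blast
    \<comment> \<open>Every term of the expanded product is below \<open>p\<close>: the first two
      have \<open>p\<close> as a factor, the last is the assumption.\<close>
    have "sup p x * sup p y = sup (sup p x * p) (sup (y * p) (x * y))"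
      by (simp add: quantale_mult_sup mult.commute)
    also have "\<dots> \<le> p"
      using that by (simp add: quantale_mult_le_right)
    finally have "m * n \<le> p"
      using quantale_mult_mono[OF mn(3,4)] by order
    then show False
      using p M_mult mn by (auto simp: X_def)
  qed
  moreover have "p < top"
    using p M(2) by (auto simp: X_def simp flip: less_top)
  ultimately have "p \<in> Spec"
    by (auto simp: Spec_def m_prime_def)
  with p that show thesis
    by (auto simp: X_def)
qed

text \<open>Zorn's lemma for the reversed order: the meet of a nonempty chain of m-primes is again
  m-prime.\<close>

lemma ex_Min_Spec_le:
  fixes p :: "'a::quantale"
  assumes "p \<in> Spec"
  shows "\<exists>q\<in>Min_Spec. q \<le> p"
proof -
  define X :: "'a set" where "X = {q \<in> Spec. q \<le> p}"
  have "\<exists>q\<in>X. \<forall>r\<in>X. r \<le> q \<longrightarrow> r = q"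
  proof (rule predicate_Zorn)
    show "partial_order_on X (relation_of (\<lambda>x y. y \<le> x) X)"
      by (rule partial_order_on_relation_ofI) auto
  next
    fix C assume C: "C \<in> Chains (relation_of (\<lambda>x y. y \<le> x) X)"
    have CX: "C \<subseteq> X" and chain: "x \<le> y \<or> y \<le> x" if "x \<in> C" "y \<in> C" for x y
      using C that by (auto simp: Chains_def relation_of_def)
    show "\<exists>u\<in>X. \<forall>x\<in>C. u \<le> x"
    proof (cases "C = {}")
      case True
      then show ?thesis using assms by (auto simp: X_def)
    next
      case False
      then obtain r where r: "r \<in> C" by blast
      then have rX: "r \<in> X" "Inf C \<le> r"
        using CX by (auto intro: Inf_lower)
      have "x \<le> Inf C \<or> y \<le> Inf C" if xy: "x * y \<le> Inf C" for x y
      proof (rule ccontr)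
        assume "\<not> ?thesis"
        then obtain s t where st: "s \<in> C" "t \<in> C" "\<not> x \<le> s" "\<not> y \<le> t"
          by (meson le_Inf_iff)
        \<comment> \<open>The smaller of \<open>s\<close> and \<open>t\<close> serves as
          \<open>u\<close>, since anything below it is below both.\<close>
        then obtain u where u: "u \<in> C" "\<not> x \<le> u" "\<not> y \<le> u"
          using chain by (meson order_trans)
        then have "u \<in> Spec" "x * y \<le> u"
          using CX xy by (auto simp: X_def le_Inf_iff)
        then show False
          using u SpecD by blast
      qed
      moreover have "Inf C < top"
        using rX by (auto simp: X_def Spec_def m_prime_def)
      ultimately have "Inf C \<in> X"
        using rX by (auto simp: X_def Spec_def m_prime_def)
      then show ?thesis
        by (auto intro: Inf_lower)
    qed
  qed
  then obtain q where q: "q \<in> X" "\<And>r. r \<in> X \<Longrightarrow> r \<le> q \<Longrightarrow> r = q"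
    by blast
  then have "q \<in> Min_Spec"
    by (auto simp: Min_Spec_def X_def dest: order_trans)
  with q(1) show ?thesis
    by (auto simp: X_def)
qed

section \<open>Coherent quantales\<close>

text \<open>Compact elements are join-dense, so they suffice to test an inequality. Read
  contrapositively, this supplies compact witnesses for a failing one.\<close>

lemma coherent_leI:
  assumes "coherent_quantale TYPE('a::quantale)"
    and le: "\<And>c. c \<in> compact_elements \<Longrightarrow> c \<le> (a::'a) \<Longrightarrow> c \<le> b"
  shows "a \<le> b"
proof -
  obtain S where "S \<subseteq> compact_elements" "a = Sup S"
    using assms(1) unfolding coherent_quantale_def by blast
  then show ?thesis
    using le by (auto intro!: Sup_least simp: Sup_upper)
qed

lemma compact_mult:
  assumes "coherent_quantale TYPE('a::quantale)" "(c::'a) \<in> compact_elements" "d \<in> compact_elements"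
  shows "c * d \<in> compact_elements"
  using assms by (auto simp: coherent_quantale_def)

lemma compact_top:
  assumes "coherent_quantale TYPE('a::quantale)"
  shows "(top::'a) \<in> compact_elements"
  using assms by (auto simp: coherent_quantale_def)

lemma compact_power:
  assumes "coherent_quantale TYPE('a::quantale)" "(c::'a) \<in> compact_elements"
  shows "c ^ n \<in> compact_elements"
  using assms by (induction n) (auto simp: one_eq_top compact_top compact_mult)

text \<open>Separation for \<open>M = {top}\<close>: avoiding \<open>top\<close> just means being
  proper.\<close>

lemma ex_Spec_ge:
  fixes a :: "'a::quantale"
  assumes "coherent_quantale TYPE('a)" "a \<noteq> top"
  shows "\<exists>p\<in>Spec. a \<le> p"
  using prime_separation[of "{top}" a] compact_top[OF assms(1)] assms(2)
  by (auto simp: quantale_mult_top top_unique)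

lemma compact_le_radical_bot:
  fixes c :: "'a::quantale"
  assumes coh: "coherent_quantale TYPE('a)" and c: "c \<in> compact_elements" "c \<le> radical bot"
  shows "\<exists>n. c ^ n = bot"
proof (rule ccontr)
  assume n: "\<not> ?thesis"
  obtain p where p: "p \<in> Spec" "\<And>m. m \<in> range ((^) c) \<Longrightarrow> \<not> m \<le> p"
  proof (rule prime_separation[of "range ((^) c)" bot])
    show "range ((^) c) \<subseteq> compact_elements"
      using compact_power[OF coh c(1)] by auto
    show "m * n \<in> range ((^) c)" if "m \<in> range ((^) c)" "n \<in> range ((^) c)" for m n
      using that by (auto simp flip: power_add)
    show "\<not> m \<le> bot" if "m \<in> range ((^) c)" for m
      using n that by (auto simp: bot_unique)
  qed auto
  from p(2)[of "c ^ 1"] have "\<not> c \<le> p"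
    by (metis power_one_right rangeI)
  with p(1) c(2) show False
    by (auto simp: radical_def le_Inf_iff)
qed

text \<open>An m-prime \<open>q\<close> avoiding \<open>M\<close> works: \<open>n = 0\<close> puts
  every compact \<open>s\<close> not below \<open>p\<close> into \<open>M\<close>, forcing
  \<open>q \<le> p\<close>, and \<open>s = top\<close>, \<open>n = 1\<close> puts \<open>c\<close>
  there. For minimal \<open>p\<close> the result says that \<open>c \<le> p\<close> excludes
  \<open>c\<^sup>\<perp> \<le> p\<close>.\<close>

lemma ex_Spec_le_avoiding:
  fixes c :: "'a::quantale"
  assumes coh: "coherent_quantale TYPE('a)" and semi: "semiprime_quantale TYPE('a)"
    and p: "p \<in> Spec" and c: "c \<in> compact_elements" "c\<^sup>\<perp> \<le> p"
  shows "\<exists>q\<in>Spec. q \<le> p \<and> \<not> c \<le> q"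
proof -
  define M where "M = {s * c ^ n | s n. s \<in> compact_elements \<and> \<not> s \<le> p}"
  have M_I: "s * c ^ n \<in> M" if "s \<in> compact_elements" "\<not> s \<le> p" for s n
    using that by (auto simp: M_def)
  have top: "(top::'a) \<in> compact_elements" "\<not> top \<le> p"
    using coh p by (auto simp: compact_top dest: Spec_not_top)
  obtain q where q: "q \<in> Spec" "\<And>m. m \<in> M \<Longrightarrow> \<not> m \<le> q"
  proof (rule prime_separation[of M bot])
    show "M \<subseteq> compact_elements"
      using coh c(1) by (auto simp: M_def intro!: compact_mult compact_power)
    show "M \<noteq> {}"
      using M_I[OF top] by blast
  next
    fix x y assume "x \<in> M" "y \<in> M"
    then obtain s t m n where st: "s \<in> compact_elements" "\<not> s \<le> p" "t \<in> compact_elements" "\<not> t \<le> p"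
      and xy: "x = s * c ^ m" "y = t * c ^ n"
      by (auto simp: M_def)
    have "x * y = (s * t) * c ^ (m + n)"
      by (simp add: xy power_add ac_simps)
    moreover have "\<not> s * t \<le> p"
      using SpecD[OF p] st by blast
    ultimately show "x * y \<in> M"
      using M_I compact_mult[OF coh] st by metis
  next
    fix m assume "m \<in> M"
    then obtain s n where s: "m = s * c ^ n" "\<not> s \<le> p"
      by (auto simp: M_def)
    show "\<not> m \<le> bot"
    proof
      assume "m \<le> bot"
      then have m: "s * c ^ n \<le> r" for r
        by (simp add: s(1) bot_unique)
      \<comment> \<open>Semiprimeness removes the exponent, since every m-prime above
        \<open>s * c ^ n\<close> is above \<open>s\<close> or \<open>c\<close>. Then
        \<open>s \<le> c\<^sup>\<perp> \<le> p\<close>, against the choice of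
        \<open>s\<close>.\<close>
      have "c * s = bot"
      proof (rule semiprime_eq_botI[OF semi])
        fix r :: 'a assume "r \<in> Spec"
        then have "s \<le> r \<or> c \<le> r"
          using m SpecD Spec_powerD by blast
        then show "c * s \<le> r"
          by (meson order_trans quantale_mult_le_left quantale_mult_le_right)
      qed
      then show False
        using s(2) c(2) by (meson le_annihilator_iff order_trans)
    qed
  qed blast
  have "q \<le> p"
  proof (rule coherent_leI[OF coh], rule ccontr)
    fix s assume "s \<in> compact_elements" "s \<le> q" "\<not> s \<le> p"
    then show False
      using M_I[of s 0] q(2) by auto
  qed
  moreover have "\<not> c \<le> q"
    using M_I[OF top, of 1] q(2) by (auto simp flip: one_eq_top)
  ultimately show ?thesis
    using q(1) by blast
qed

section \<open>Consequences and characterizations of the PF condition\<close>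

lemma PF_quantale_iff_sup_annihilator_eq_top:
  "PF_quantale TYPE('a::quantale) \<longleftrightarrow>
    (\<forall>c\<in>(compact_elements::'a set). \<forall>d\<in>compact_elements.
       c * d = bot \<longrightarrow> sup (c\<^sup>\<perp>) (d\<^sup>\<perp>) = top)"
  \<comment> \<open>The premise \<open>d \<le> c\<^sup>\<perp>\<close> in the purity of
    \<open>c\<^sup>\<perp>\<close> is the equation \<open>c * d = bot\<close>.\<close>
  by (simp add: PF_quantale_def pure_element_def le_annihilator_iff)

text \<open>A compact \<open>x\<close> annihilating \<open>c * d\<close> makes \<open>c\<close> and
  \<open>d * x\<close> a compact pair with product \<open>bot\<close>. Their annihilators join to
  \<open>top\<close>, and multiplying by \<open>x\<close> splits \<open>x\<close> into parts below
  \<open>c\<^sup>\<perp>\<close> and \<open>d\<^sup>\<perp>\<close>.\<close>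

lemma PF_quantale_annihilator_mult:
  fixes c d :: "'a::quantale"
  assumes coh: "coherent_quantale TYPE('a)" and PF: "PF_quantale TYPE('a)"
    and c: "c \<in> compact_elements" and d: "d \<in> compact_elements"
  shows "(c * d)\<^sup>\<perp> = sup (c\<^sup>\<perp>) (d\<^sup>\<perp>)"
proof (rule antisym[OF coherent_leI[OF coh] sup_annihilator_le])
  fix x assume x: "x \<in> compact_elements" "x \<le> (c * d)\<^sup>\<perp>"
  then have "c * (d * x) = bot"
    by (simp add: le_annihilator_iff mult.assoc)
  then have "sup (c\<^sup>\<perp>) ((d * x)\<^sup>\<perp>) = top"
    using PF c compact_mult[OF coh d x(1)]
    by (simp add: PF_quantale_iff_sup_annihilator_eq_top)
  then have "x = sup (x * c\<^sup>\<perp>) (x * (d * x)\<^sup>\<perp>)"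
    by (metis quantale_mult_sup quantale_mult_top)
  moreover have "x * (d * x)\<^sup>\<perp> \<le> d\<^sup>\<perp>"
    by (metis le_annihilator_iff mult.assoc mult_annihilator)
  moreover have "x * c\<^sup>\<perp> \<le> c\<^sup>\<perp>"
    by (rule quantale_mult_le_right)
  ultimately show "x \<le> sup (c\<^sup>\<perp>) (d\<^sup>\<perp>)"
    by (metis sup_mono sup.commute)
qed

text \<open>The product formula keeps annihilators of powers of \<open>c\<close> below
  \<open>c\<^sup>\<perp>\<close>. A nilpotent \<open>c\<close> therefore has annihilator
  \<open>top\<close> and must be \<open>bot\<close>.\<close>

lemma PF_quantale_imp_semiprime:
  assumes coh: "coherent_quantale TYPE('a::quantale)" and PF: "PF_quantale TYPE('a)"
  shows "semiprime_quantale TYPE('a)"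
proof -
  have "radical bot \<le> (bot::'a)"
  proof (rule coherent_leI[OF coh])
    fix c :: 'a assume c: "c \<in> compact_elements" "c \<le> radical bot"
    have le: "(c ^ n)\<^sup>\<perp> \<le> c\<^sup>\<perp>" for n
    proof (induction n)
      case (Suc n)
      then show ?case
        using PF_quantale_annihilator_mult[OF coh PF c(1) compact_power[OF coh c(1)]] by simp
    qed (simp add: one_eq_top annihilator_top)
    obtain n where "c ^ n = bot"
      using compact_le_radical_bot[OF coh c] by blast
    with le[of n] show "c \<le> bot"
      by (metis annihilator_eq_top_iff top_unique order_refl)
  qed
  then show ?thesis
    by (simp add: semiprime_quantale_def bot_unique)
qed

text \<open>Two minimal m-primes \<open>q\<close>, \<open>r\<close> below \<open>p\<close> with
  \<open>\<not> q \<le> r\<close> would yield compact \<open>c\<close>, \<open>d\<close> with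
  \<open>c * d = bot\<close> whose annihilators lie below \<open>r\<close> and \<open>q\<close>.
  Both are then below \<open>p\<close>, although their join is \<open>top\<close>.\<close>

lemma PF_quantale_imp_mp:
  assumes coh: "coherent_quantale TYPE('a::quantale)" and PF: "PF_quantale TYPE('a)"
  shows "mp_quantale TYPE('a)"
proof -
  note semi = PF_quantale_imp_semiprime[OF coh PF]
  have le: "q \<le> r" if p: "p \<in> Spec" and q: "q \<in> Min_Spec" "q \<le> p" and r: "r \<in> Min_Spec" "r \<le> p"
    for p q r :: 'a
  proof (rule coherent_leI[OF coh], rule ccontr)
    fix c assume c: "c \<in> compact_elements" "c \<le> q" "\<not> c \<le> r"
    have qr: "q \<in> Spec" "r \<in> Spec"
      using q r by (auto simp: Min_Spec_def)
    \<comment> \<open>Otherwise some m-prime below \<open>q\<close> would avoid \<open>c\<close>; by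
      minimality it is \<open>q\<close>, yet \<open>c \<le> q\<close>.\<close>
    have "\<not> c\<^sup>\<perp> \<le> q"
      using ex_Spec_le_avoiding[OF coh semi qr(1) c(1)] q(1) c(2) by (auto simp: Min_Spec_def)
    then obtain d where d: "d \<in> compact_elements" "d \<le> c\<^sup>\<perp>" "\<not> d \<le> q"
      using coherent_leI[OF coh] by blast
    then have "sup (c\<^sup>\<perp>) (d\<^sup>\<perp>) = top"
      using PF c(1) by (simp add: PF_quantale_iff_sup_annihilator_eq_top le_annihilator_iff)
    moreover have "c\<^sup>\<perp> \<le> p" "d\<^sup>\<perp> \<le> p"
      using Spec_annihilator_le qr c(3) d(3) q(2) r(2) by (blast intro: order_trans)+
    ultimately show False
      using Spec_not_top[OF p] by (metis sup_least)
  qed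
  show ?thesis
    unfolding mp_quantale_def
    \<comment> \<open>Applying \<open>le\<close> in both directions gives uniqueness.\<close>
    using ex_Min_Spec_le le by (blast intro: antisym)
qed

text \<open>If the join were proper, an m-prime \<open>p\<close> would lie above both annihilators.
  The avoiding m-primes for \<open>c\<close> and for \<open>d\<close> below \<open>p\<close> both
  lie above the unique minimal \<open>q\<close>, so \<open>q\<close> is above neither factor of
  \<open>c * d = bot\<close>.\<close>

lemma semiprime_mp_imp_PF_quantale:
  assumes coh: "coherent_quantale TYPE('a::quantale)"
    and semi: "semiprime_quantale TYPE('a)" and mp: "mp_quantale TYPE('a)"
  shows "PF_quantale TYPE('a)"
  unfolding PF_quantale_iff_sup_annihilator_eq_top
proof (intro ballI impI, rule ccontr)
  fix c d :: 'a
  assume cd: "c \<in> compact_elements" "d \<in> compact_elements" "c * d = bot"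
    and "sup (c\<^sup>\<perp>) (d\<^sup>\<perp>) \<noteq> top"
  then obtain p where p: "p \<in> Spec" "c\<^sup>\<perp> \<le> p" "d\<^sup>\<perp> \<le> p"
    using ex_Spec_ge[OF coh] by (metis le_sup_iff)
  obtain q where q: "q \<in> Min_Spec" "q \<le> p"
    using ex_Min_Spec_le[OF p(1)] by blast
  have not_le: "\<not> e \<le> q" if e: "e \<in> compact_elements" "e\<^sup>\<perp> \<le> p" for e
  proof
    assume "e \<le> q"
    obtain r where r: "r \<in> Spec" "r \<le> p" "\<not> e \<le> r"
      using ex_Spec_le_avoiding[OF coh semi p(1) e] by blast
    obtain q' where q': "q' \<in> Min_Spec" "q' \<le> r"
      using ex_Min_Spec_le[OF r(1)] by blast
    then have "q' \<le> p"
      using r(2) by order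
    then have "q' = q"
      using mp p(1) q q'(1) unfolding mp_quantale_def by blast
    then show False
      using \<open>e \<le> q\<close> q'(2) r(3) by (meson order_trans)
  qed
  have "c \<le> q \<or> d \<le> q"
    using q(1) cd(3) by (intro SpecD) (auto simp: Min_Spec_def)
  then show False
    using not_le cd p by blast
qed

theorem theorem8p22:
  assumes "coherent_quantale TYPE('a::quantale)"
  shows "(PF_quantale TYPE('a) \<longleftrightarrow> semiprime_quantale TYPE('a) \<and> mp_quantale TYPE('a))
    \<and> (PF_quantale TYPE('a) \<longleftrightarrow>
        (\<forall>c\<in>(compact_elements::'a set). \<forall>d\<in>compact_elements.
           c * d = bot \<longrightarrow> sup (c\<^sup>\<perp>) (d\<^sup>\<perp>) = top))
    \<and> (PF_quantale TYPE('a) \<longleftrightarrow>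
        (\<forall>c\<in>(compact_elements::'a set). \<forall>d\<in>compact_elements.
           (c * d)\<^sup>\<perp> = sup (c\<^sup>\<perp>) (d\<^sup>\<perp>)))
    \<and> (PF_quantale TYPE('a) \<longleftrightarrow>
        (\<forall>c\<in>(compact_elements::'a set). pure_element (c\<^sup>\<perp>)))"
proof (intro conjI)
  show "PF_quantale TYPE('a) \<longleftrightarrow> semiprime_quantale TYPE('a) \<and> mp_quantale TYPE('a)"
    using assms PF_quantale_imp_semiprime PF_quantale_imp_mp semiprime_mp_imp_PF_quantale by blast
  show "PF_quantale TYPE('a) \<longleftrightarrow>
      (\<forall>c\<in>(compact_elements::'a set). \<forall>d\<in>compact_elements.
         (c * d)\<^sup>\<perp> = sup (c\<^sup>\<perp>) (d\<^sup>\<perp>))"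
  proof
    assume "\<forall>c\<in>(compact_elements::'a set). \<forall>d\<in>compact_elements. (c * d)\<^sup>\<perp> = sup (c\<^sup>\<perp>) (d\<^sup>\<perp>)"
    \<comment> \<open>For \<open>c * d = bot\<close> the left side of the formula is
      \<open>top\<close>.\<close>
    then show "PF_quantale TYPE('a)"
      unfolding PF_quantale_iff_sup_annihilator_eq_top by (metis annihilator_eq_top_iff)
  qed (use assms PF_quantale_annihilator_mult in blast)
qed (rule PF_quantale_iff_sup_annihilator_eq_top PF_quantale_def)+

end
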